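(* Let $G$ be a group, $A$ a $G$-graded ring and $M$ a $G$-graded $(A,A)$-bimodule. Then the $G$-graded trivial extension $R=A\propto M$ is graded NR-clean if and only if $A$ is graded NR-clean.
   Context: All rings are associative with unity (not necessarily commutative). A ring $R$ is $G$-graded if $R=\bigoplus_{g\in G}R_g$ with $R_g$ additive subgroups and $R_gR_h\subseteq R_{gh}$ for all $g,h\in G$. The elements of $h(R)=\bigcup_{g\in G}R_g$ are called homogeneous. A homogeneous element $r$ is graded-regular if $r=rar$ for some $a\in h(R)$; $gr(R)$ is the set of graded-regular elements and $N(R)$ is the set of nilpotent elements of $R$. A $G$-graded ring $R$ is graded NR-clean if every $x\in h(R)$ can be written $x=r+n$ with $r\in gr(R)$ and $n\in N(R)\cap h(R)$. A $G$-graded $(A,A)$-bimodule is an $(A,A)$-bimodule $M=\bigoplus_{g\in G}M_g$, with $M_g$ additive subgroups, such that $A_hM_g\subseteq M_{hg}$ and $M_gA_h\subseteq M_{gh}$ for all $g,h\in G$. The trivial extension $A\propto M$ is the set of pairs $(a,m)$, $a\in A$, $m\in M$, with componentwise addition and multiplication $(a,m)(b,m')=(ab,am'+mb)$; it is $G$-graded with $g$-component $A_g\oplus M_g$ (pairs $(a,m)$ with $a\in A_g$, $m\in M_g$). *)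

theory Defs
  imports "HOL-Algebra.Module" "HOL-Algebra.AbelCoset"
begin

section \<open>Graded rings and graded bimodules\<close>

text \<open>
  Internal direct sum of a family of additive subgroups, indexed by a possibly infinite set \<open>I\<close>:
  every element is in a unique way a sum of a finitely supported family of components.
  Families are taken extensional, so that uniqueness only concerns the indices in \<open>I\<close>. Only the
  additive structure of \<open>M\<close> is used, so \<open>M\<close> can be a ring or a module.
\<close>

definition internal_direct_sum :: "('a, 'm) ring_scheme \<Rightarrow> 'i set \<Rightarrow> ('i \<Rightarrow> 'a set) \<Rightarrow> bool" where
  "internal_direct_sum M I S \<longleftrightarrow>
     (\<forall>i\<in>I. additive_subgroup (S i) M) \<and>
     (\<forall>x\<in>carrier M. \<exists>!f. f \<in> (\<Pi>\<^sub>E i\<in>I. S i) \<and> finite {i \<in> I. f i \<noteq> \<zero>\<^bsub>M\<^esub>} \<and>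
        x = finsum M f {i \<in> I. f i \<noteq> \<zero>\<^bsub>M\<^esub>})"

locale graded_ring = G?: group G + R?: ring R
  for G :: "('g, 'k) monoid_scheme" (structure) and R :: "('a, 'b) ring_scheme" (structure) +
  fixes compR :: "'g \<Rightarrow> 'a set"
  assumes direct_sum: "internal_direct_sum R (carrier G) compR"
    and comp_mult: "\<lbrakk>g \<in> carrier G; h \<in> carrier G; a \<in> compR g; b \<in> compR h\<rbrakk>
      \<Longrightarrow> a \<otimes>\<^bsub>R\<^esub> b \<in> compR (g \<otimes>\<^bsub>G\<^esub> h)"

text \<open>
  The left action and the additive group come from the library record of modules, which has
  to be extended by a right action. The library locale for modules is not applicable, as it
  requires commutative scalars. As for library modules, the fields \<open>mult\<close> and \<open>one\<close> inherited from the ring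
  record are irrelevant.
\<close>

record ('a, 'm) bimodule = "('a, 'm) module" +
  rsmult :: "'m \<Rightarrow> 'a \<Rightarrow> 'm"  (infixl \<open>\<odot>\<^sub>r\<index>\<close> 70)

locale bimodule = A?: ring A + M?: abelian_group M
  for A :: "('a, 'b) ring_scheme" (structure) and M :: "('a, 'm, 'c) bimodule_scheme" (structure) +
  assumes left_closed: "\<lbrakk>a \<in> carrier A; x \<in> carrier M\<rbrakk> \<Longrightarrow> a \<odot>\<^bsub>M\<^esub> x \<in> carrier M"
    and left_add_scalar: "\<lbrakk>a \<in> carrier A; b \<in> carrier A; x \<in> carrier M\<rbrakk>
      \<Longrightarrow> (a \<oplus>\<^bsub>A\<^esub> b) \<odot>\<^bsub>M\<^esub> x = a \<odot>\<^bsub>M\<^esub> x \<oplus>\<^bsub>M\<^esub> b \<odot>\<^bsub>M\<^esub> x"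
    and left_add: "\<lbrakk>a \<in> carrier A; x \<in> carrier M; y \<in> carrier M\<rbrakk>
      \<Longrightarrow> a \<odot>\<^bsub>M\<^esub> (x \<oplus>\<^bsub>M\<^esub> y) = a \<odot>\<^bsub>M\<^esub> x \<oplus>\<^bsub>M\<^esub> a \<odot>\<^bsub>M\<^esub> y"
    and left_assoc: "\<lbrakk>a \<in> carrier A; b \<in> carrier A; x \<in> carrier M\<rbrakk>
      \<Longrightarrow> (a \<otimes>\<^bsub>A\<^esub> b) \<odot>\<^bsub>M\<^esub> x = a \<odot>\<^bsub>M\<^esub> (b \<odot>\<^bsub>M\<^esub> x)"
    and left_one: "x \<in> carrier M \<Longrightarrow> \<one>\<^bsub>A\<^esub> \<odot>\<^bsub>M\<^esub> x = x"
    and right_closed: "\<lbrakk>a \<in> carrier A; x \<in> carrier M\<rbrakk> \<Longrightarrow> x \<odot>\<^sub>r\<^bsub>M\<^esub> a \<in> carrier M"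
    and right_add_scalar: "\<lbrakk>a \<in> carrier A; b \<in> carrier A; x \<in> carrier M\<rbrakk>
      \<Longrightarrow> x \<odot>\<^sub>r\<^bsub>M\<^esub> (a \<oplus>\<^bsub>A\<^esub> b) = x \<odot>\<^sub>r\<^bsub>M\<^esub> a \<oplus>\<^bsub>M\<^esub> x \<odot>\<^sub>r\<^bsub>M\<^esub> b"
    and right_add: "\<lbrakk>a \<in> carrier A; x \<in> carrier M; y \<in> carrier M\<rbrakk>
      \<Longrightarrow> (x \<oplus>\<^bsub>M\<^esub> y) \<odot>\<^sub>r\<^bsub>M\<^esub> a = x \<odot>\<^sub>r\<^bsub>M\<^esub> a \<oplus>\<^bsub>M\<^esub> y \<odot>\<^sub>r\<^bsub>M\<^esub> a"
    and right_assoc: "\<lbrakk>a \<in> carrier A; b \<in> carrier A; x \<in> carrier M\<rbrakk>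
      \<Longrightarrow> x \<odot>\<^sub>r\<^bsub>M\<^esub> (a \<otimes>\<^bsub>A\<^esub> b) = (x \<odot>\<^sub>r\<^bsub>M\<^esub> a) \<odot>\<^sub>r\<^bsub>M\<^esub> b"
    and right_one: "x \<in> carrier M \<Longrightarrow> x \<odot>\<^sub>r\<^bsub>M\<^esub> \<one>\<^bsub>A\<^esub> = x"
    and left_right: "\<lbrakk>a \<in> carrier A; b \<in> carrier A; x \<in> carrier M\<rbrakk>
      \<Longrightarrow> (a \<odot>\<^bsub>M\<^esub> x) \<odot>\<^sub>r\<^bsub>M\<^esub> b = a \<odot>\<^bsub>M\<^esub> (x \<odot>\<^sub>r\<^bsub>M\<^esub> b)"

locale graded_bimodule = bimodule A M + graded_ring G A compA
  for G :: "('g, 'k) monoid_scheme" (structure) and A :: "('a, 'b) ring_scheme" (structure)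
    and compA :: "'g \<Rightarrow> 'a set" and M :: "('a, 'm, 'c) bimodule_scheme" (structure) +
  fixes compM :: "'g \<Rightarrow> 'm set"
  assumes direct_sum_module: "internal_direct_sum M (carrier G) compM"
    and comp_left: "\<lbrakk>h \<in> carrier G; g \<in> carrier G; a \<in> compA h; x \<in> compM g\<rbrakk>
      \<Longrightarrow> a \<odot>\<^bsub>M\<^esub> x \<in> compM (h \<otimes>\<^bsub>G\<^esub> g)"
    and comp_right: "\<lbrakk>g \<in> carrier G; h \<in> carrier G; x \<in> compM g; a \<in> compA h\<rbrakk>
      \<Longrightarrow> x \<odot>\<^sub>r\<^bsub>M\<^esub> a \<in> compM (g \<otimes>\<^bsub>G\<^esub> h)"


section \<open>Graded NR-clean rings\<close>

definition homogeneous :: "('g, 'k) monoid_scheme \<Rightarrow> ('g \<Rightarrow> 'a set) \<Rightarrow> 'a set" where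
  "homogeneous G compR = (\<Union>g\<in>carrier G. compR g)"

definition graded_regular ::
    "('g, 'k) monoid_scheme \<Rightarrow> ('a, 'b) ring_scheme \<Rightarrow> ('g \<Rightarrow> 'a set) \<Rightarrow> 'a set" where
  "graded_regular G R compR =
     {r \<in> homogeneous G compR. \<exists>a\<in>homogeneous G compR. r = r \<otimes>\<^bsub>R\<^esub> a \<otimes>\<^bsub>R\<^esub> r}"

definition nilpotents :: "('a, 'b) ring_scheme \<Rightarrow> 'a set" where
  "nilpotents R = {x \<in> carrier R. \<exists>n::nat. n > 0 \<and> x [^]\<^bsub>R\<^esub> n = \<zero>\<^bsub>R\<^esub>}"

definition graded_NR_clean ::
    "('g, 'k) monoid_scheme \<Rightarrow> ('a, 'b) ring_scheme \<Rightarrow> ('g \<Rightarrow> 'a set) \<Rightarrow> bool" where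
  "graded_NR_clean G R compR \<longleftrightarrow>
     (\<forall>x\<in>homogeneous G compR. \<exists>r\<in>graded_regular G R compR.
        \<exists>n\<in>nilpotents R \<inter> homogeneous G compR. x = r \<oplus>\<^bsub>R\<^esub> n)"


section \<open>Trivial extensions\<close>

definition trivial_extension ::
    "('a, 'b) ring_scheme \<Rightarrow> ('a, 'm, 'c) bimodule_scheme \<Rightarrow> ('a \<times> 'm) ring"
    (infixl \<open>\<propto>\<close> 65) where
  "A \<propto> M =
     \<lparr>carrier = carrier A \<times> carrier M,
      mult = (\<lambda>(a, m) (b, m'). (a \<otimes>\<^bsub>A\<^esub> b, a \<odot>\<^bsub>M\<^esub> m' \<oplus>\<^bsub>M\<^esub> m \<odot>\<^sub>r\<^bsub>M\<^esub> b)),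
      one = (\<one>\<^bsub>A\<^esub>, \<zero>\<^bsub>M\<^esub>),
      zero = (\<zero>\<^bsub>A\<^esub>, \<zero>\<^bsub>M\<^esub>),
      add = (\<lambda>(a, m) (b, m'). (a \<oplus>\<^bsub>A\<^esub> b, m \<oplus>\<^bsub>M\<^esub> m'))\<rparr>"

definition trivial_extension_comp :: "('g \<Rightarrow> 'a set) \<Rightarrow> ('g \<Rightarrow> 'm set) \<Rightarrow> 'g \<Rightarrow> ('a \<times> 'm) set" where
  "trivial_extension_comp compA compM g = compA g \<times> compM g"

lemma trivial_extension_simps:
  "carrier (A \<propto> M) = carrier A \<times> carrier M"
  "(a, m) \<otimes>\<^bsub>A \<propto> M\<^esub> (b, m') = (a \<otimes>\<^bsub>A\<^esub> b, a \<odot>\<^bsub>M\<^esub> m' \<oplus>\<^bsub>M\<^esub> m \<odot>\<^sub>r\<^bsub>M\<^esub> b)"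
  "\<one>\<^bsub>A \<propto> M\<^esub> = (\<one>\<^bsub>A\<^esub>, \<zero>\<^bsub>M\<^esub>)"
  "\<zero>\<^bsub>A \<propto> M\<^esub> = (\<zero>\<^bsub>A\<^esub>, \<zero>\<^bsub>M\<^esub>)"
  "(a, m) \<oplus>\<^bsub>A \<propto> M\<^esub> (b, m') = (a \<oplus>\<^bsub>A\<^esub> b, m \<oplus>\<^bsub>M\<^esub> m')"
  by (simp_all add: trivial_extension_def)

context bimodule
begin

lemma trivial_extension_ring: "ring (A \<propto> M)"
proof (rule ringI)
  show "abelian_group (A \<propto> M)"
  proof (rule abelian_groupI)
    fix x assume "x \<in> carrier (A \<propto> M)"
    then show "\<exists>y\<in>carrier (A \<propto> M). y \<oplus>\<^bsub>A \<propto> M\<^esub> x = \<zero>\<^bsub>A \<propto> M\<^esub>"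
      by (cases x) (auto simp: trivial_extension_simps
          intro!: bexI[of _ "(\<ominus>\<^bsub>A\<^esub> fst x, \<ominus>\<^bsub>M\<^esub> snd x)"] A.l_neg M.l_neg)
  qed (auto simp: trivial_extension_simps A.a_ac M.a_ac)
next
  have z1: "a \<odot>\<^bsub>M\<^esub> \<zero>\<^bsub>M\<^esub> = \<zero>\<^bsub>M\<^esub>" if "a \<in> carrier A" for a
    using left_add[OF that, of "\<zero>\<^bsub>M\<^esub>" "\<zero>\<^bsub>M\<^esub>"] left_closed[OF that, of "\<zero>\<^bsub>M\<^esub>"]
      M.add.l_cancel_one' by force
  have z2: "\<zero>\<^bsub>M\<^esub> \<odot>\<^sub>r\<^bsub>M\<^esub> a = \<zero>\<^bsub>M\<^esub>" if "a \<in> carrier A" for a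
    using right_add[OF that, of "\<zero>\<^bsub>M\<^esub>" "\<zero>\<^bsub>M\<^esub>"] right_closed[OF that, of "\<zero>\<^bsub>M\<^esub>"]
      M.add.l_cancel_one' by force
  show "monoid (A \<propto> M)"
    by (rule monoidI) (auto simp: trivial_extension_simps left_closed right_closed A.m_assoc
        left_add right_add left_assoc right_assoc left_right left_one right_one z1 z2 M.a_ac)
qed (auto simp: trivial_extension_simps left_closed right_closed A.l_distr A.r_distr
    left_add_scalar right_add_scalar left_add right_add M.a_ac)

lemma trivial_extension_finsum:
  assumes "finite S" "f \<in> S \<rightarrow> carrier A" "h \<in> S \<rightarrow> carrier M"
  shows "finsum (A \<propto> M) (\<lambda>i. (f i, h i)) S = (finsum A f S, finsum M h S)"
proof -
  interpret T: ring "A \<propto> M" by (rule trivial_extension_ring)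
  show ?thesis using assms
    by (induction S rule: finite_induct)
      (simp_all add: trivial_extension_simps Pi_def)
qed

end

lemma finsum_support:
  assumes "abelian_group M" "f \<in> I \<rightarrow> carrier M" "finite T" "{i \<in> I. f i \<noteq> \<zero>\<^bsub>M\<^esub>} \<subseteq> T" "T \<subseteq> I"
  shows "finsum M f {i \<in> I. f i \<noteq> \<zero>\<^bsub>M\<^esub>} = finsum M f T"
proof -
  interpret abelian_group M by fact
  show ?thesis
    by (rule add.finprod_mono_neutral_cong_left) (use assms in auto)
qed

context graded_bimodule
begin

lemma trivial_extension_direct_sum:
  "internal_direct_sum (A \<propto> M) (carrier G) (trivial_extension_comp compA compM)"
  (is "internal_direct_sum ?T ?I ?C")
proof -
  interpret T: ring ?T by (rule trivial_extension_ring)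
  have subA: "\<And>g. g \<in> ?I \<Longrightarrow> additive_subgroup (compA g) A"
    and subM: "\<And>g. g \<in> ?I \<Longrightarrow> additive_subgroup (compM g) M"
    using direct_sum direct_sum_module by (auto simp: internal_direct_sum_def)
  have cA: "\<And>g. g \<in> ?I \<Longrightarrow> compA g \<subseteq> carrier A" and cM: "\<And>g. g \<in> ?I \<Longrightarrow> compM g \<subseteq> carrier M"
    using subA subM additive_subgroup.a_subset by blast+
  have "additive_subgroup (?C g) ?T" if g: "g \<in> ?I" for g
  proof -
    interpret a: additive_subgroup "compA g" A by (rule subA[OF g])
    interpret m: additive_subgroup "compM g" M by (rule subM[OF g])
    have inv: "\<ominus>\<^bsub>?T\<^esub> (x, y) = (\<ominus>\<^bsub>A\<^esub> x, \<ominus>\<^bsub>M\<^esub> y)" if "x \<in> carrier A" "y \<in> carrier M" for x y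
      by (rule T.minus_equality)
        (use that in \<open>auto simp: trivial_extension_simps A.l_neg M.l_neg\<close>)
    have "subgroup (?C g) (add_monoid ?T)"
    proof (rule T.add.subgroupI)
      fix x assume x: "x \<in> ?C g"
      then have "fst x \<in> carrier A" "snd x \<in> carrier M"
        using cA[OF g] cM[OF g] by (auto simp: trivial_extension_comp_def)
      then have "\<ominus>\<^bsub>?T\<^esub> x = (\<ominus>\<^bsub>A\<^esub> fst x, \<ominus>\<^bsub>M\<^esub> snd x)"
        using inv[of "fst x" "snd x"] by simp
      then show "\<ominus>\<^bsub>?T\<^esub> x \<in> ?C g"
        using x A.ring_axioms M.abelian_group_axioms
        by (auto simp: trivial_extension_comp_def intro: a.a_inv_closed m.a_inv_closed
            ring.is_abelian_group)
    next
      show "?C g \<noteq> {}" unfolding trivial_extension_comp_def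
        using a.zero_closed m.zero_closed by blast
    next
      show "?C g \<subseteq> carrier ?T"
        using cA[OF g] cM[OF g] by (auto simp: trivial_extension_comp_def trivial_extension_simps)
    qed (auto simp: trivial_extension_comp_def trivial_extension_simps)
    then show ?thesis by (rule additive_subgroupI)
  qed
  moreover have "\<exists>!f. f \<in> (\<Pi>\<^sub>E i\<in>?I. ?C i) \<and> finite {i \<in> ?I. f i \<noteq> \<zero>\<^bsub>?T\<^esub>} \<and>
        x = finsum ?T f {i \<in> ?I. f i \<noteq> \<zero>\<^bsub>?T\<^esub>}" if x: "x \<in> carrier ?T" for x
  proof -
    let ?PA = "\<lambda>f a. f \<in> (\<Pi>\<^sub>E i\<in>?I. compA i) \<and> finite {i \<in> ?I. f i \<noteq> \<zero>\<^bsub>A\<^esub>} \<and>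
        a = finsum A f {i \<in> ?I. f i \<noteq> \<zero>\<^bsub>A\<^esub>}"
    let ?PM = "\<lambda>f m. f \<in> (\<Pi>\<^sub>E i\<in>?I. compM i) \<and> finite {i \<in> ?I. f i \<noteq> \<zero>\<^bsub>M\<^esub>} \<and>
        m = finsum M f {i \<in> ?I. f i \<noteq> \<zero>\<^bsub>M\<^esub>}"
    have split: "finsum ?T f {i \<in> ?I. f i \<noteq> \<zero>\<^bsub>?T\<^esub>} =
        (finsum A (fst \<circ> f) {i \<in> ?I. (fst \<circ> f) i \<noteq> \<zero>\<^bsub>A\<^esub>},
         finsum M (snd \<circ> f) {i \<in> ?I. (snd \<circ> f) i \<noteq> \<zero>\<^bsub>M\<^esub>})"
      if f: "f \<in> (\<Pi> i\<in>?I. ?C i)" and fin: "finite {i \<in> ?I. f i \<noteq> \<zero>\<^bsub>?T\<^esub>}" for f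
    proof -
      let ?S = "{i \<in> ?I. f i \<noteq> \<zero>\<^bsub>?T\<^esub>}"
      have fA: "fst \<circ> f \<in> ?I \<rightarrow> carrier A" and fM: "snd \<circ> f \<in> ?I \<rightarrow> carrier M"
        using f cA cM by (fastforce simp: trivial_extension_comp_def Pi_def)+
      have "finsum ?T (\<lambda>i. ((fst \<circ> f) i, (snd \<circ> f) i)) ?S =
          (finsum A (fst \<circ> f) ?S, finsum M (snd \<circ> f) ?S)"
        by (rule trivial_extension_finsum[OF fin]) (use fA fM in auto)
      moreover have "finsum A (fst \<circ> f) {i \<in> ?I. (fst \<circ> f) i \<noteq> \<zero>\<^bsub>A\<^esub>} = finsum A (fst \<circ> f) ?S"
        by (rule finsum_support[OF _ fA fin])
          (auto simp: trivial_extension_simps A.is_abelian_group)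
      moreover have "finsum M (snd \<circ> f) {i \<in> ?I. (snd \<circ> f) i \<noteq> \<zero>\<^bsub>M\<^esub>} = finsum M (snd \<circ> f) ?S"
        by (rule finsum_support[OF _ fM fin])
          (auto simp: trivial_extension_simps M.abelian_group_axioms)
      ultimately show ?thesis by simp
    qed
    obtain a m where am: "x = (a, m)" "a \<in> carrier A" "m \<in> carrier M"
      using x by (auto simp: trivial_extension_simps)
    have exA: "\<exists>!f. ?PA f a" using direct_sum am by (simp add: internal_direct_sum_def)
    have exM: "\<exists>!f. ?PM f m" using direct_sum_module am by (simp add: internal_direct_sum_def)
    obtain p where p: "?PA p a" using exA by blast
    obtain q where q: "?PM q m" using exM by blast
    let ?f = "\<lambda>i\<in>?I. (p i, q i)"
    show ?thesis
    proof (rule ex1I[of _ ?f], intro conjI)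
      show f1: "?f \<in> (\<Pi>\<^sub>E i\<in>?I. ?C i)"
        using p q by (auto simp: trivial_extension_comp_def PiE_def Pi_def)
      have f2: "?f \<in> (\<Pi> i\<in>?I. ?C i)" using f1 unfolding PiE_def by (rule IntD1)
      have "{i \<in> ?I. ?f i \<noteq> \<zero>\<^bsub>?T\<^esub>} \<subseteq> {i \<in> ?I. p i \<noteq> \<zero>\<^bsub>A\<^esub>} \<union> {i \<in> ?I. q i \<noteq> \<zero>\<^bsub>M\<^esub>}"
        by (auto simp: trivial_extension_simps)
      then show fin: "finite {i \<in> ?I. ?f i \<noteq> \<zero>\<^bsub>?T\<^esub>}"
        using p q finite_subset by (metis (no_types, lifting) finite_UnI)
      have eqA: "{i \<in> ?I. (fst \<circ> ?f) i \<noteq> \<zero>\<^bsub>A\<^esub>} = {i \<in> ?I. p i \<noteq> \<zero>\<^bsub>A\<^esub>}"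
        and eqM: "{i \<in> ?I. (snd \<circ> ?f) i \<noteq> \<zero>\<^bsub>M\<^esub>} = {i \<in> ?I. q i \<noteq> \<zero>\<^bsub>M\<^esub>}" by auto
      have "finsum A (fst \<circ> ?f) {i \<in> ?I. p i \<noteq> \<zero>\<^bsub>A\<^esub>} = finsum A p {i \<in> ?I. p i \<noteq> \<zero>\<^bsub>A\<^esub>}"
        by (rule A.add.finprod_cong') (use p cA in \<open>auto simp: PiE_def Pi_def\<close>)
      moreover have "finsum M (snd \<circ> ?f) {i \<in> ?I. q i \<noteq> \<zero>\<^bsub>M\<^esub>} = finsum M q {i \<in> ?I. q i \<noteq> \<zero>\<^bsub>M\<^esub>}"
        by (rule M.add.finprod_cong') (use q cM in \<open>auto simp: PiE_def Pi_def\<close>)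
      ultimately show "x = finsum ?T ?f {i \<in> ?I. ?f i \<noteq> \<zero>\<^bsub>?T\<^esub>}"
        unfolding split[OF f2 fin] eqA eqM using p q am by simp
    next
      fix f assume f: "f \<in> (\<Pi>\<^sub>E i\<in>?I. ?C i) \<and> finite {i \<in> ?I. f i \<noteq> \<zero>\<^bsub>?T\<^esub>} \<and>
        x = finsum ?T f {i \<in> ?I. f i \<noteq> \<zero>\<^bsub>?T\<^esub>}"
      let ?u = "\<lambda>i\<in>?I. fst (f i)" and ?v = "\<lambda>i\<in>?I. snd (f i)"
      have fC: "\<And>i. i \<in> ?I \<Longrightarrow> fst (f i) \<in> compA i" "\<And>i. i \<in> ?I \<Longrightarrow> snd (f i) \<in> compM i"
        using f by (auto simp: PiE_def Pi_def trivial_extension_comp_def mem_Times_iff)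
      have sp: "a = finsum A (fst \<circ> f) {i \<in> ?I. (fst \<circ> f) i \<noteq> \<zero>\<^bsub>A\<^esub>}"
           "m = finsum M (snd \<circ> f) {i \<in> ?I. (snd \<circ> f) i \<noteq> \<zero>\<^bsub>M\<^esub>}"
        using split[of f] f am by (auto simp: PiE_def)
      have eqA: "{i \<in> ?I. ?u i \<noteq> \<zero>\<^bsub>A\<^esub>} = {i \<in> ?I. (fst \<circ> f) i \<noteq> \<zero>\<^bsub>A\<^esub>}"
        and eqM: "{i \<in> ?I. ?v i \<noteq> \<zero>\<^bsub>M\<^esub>} = {i \<in> ?I. (snd \<circ> f) i \<noteq> \<zero>\<^bsub>M\<^esub>}" by auto
      have fin: "finite {i \<in> ?I. f i \<noteq> \<zero>\<^bsub>?T\<^esub>}" using f by blast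
      have fu: "finite {i \<in> ?I. ?u i \<noteq> \<zero>\<^bsub>A\<^esub>}"
        by (rule finite_subset[OF _ fin]) (auto simp: trivial_extension_simps)
      have fv: "finite {i \<in> ?I. ?v i \<noteq> \<zero>\<^bsub>M\<^esub>}"
        by (rule finite_subset[OF _ fin]) (auto simp: trivial_extension_simps)
      have "finsum A ?u {i \<in> ?I. ?u i \<noteq> \<zero>\<^bsub>A\<^esub>} = a" unfolding sp eqA
        by (rule A.add.finprod_cong') (use fC cA in \<open>auto simp: Pi_def\<close>)
      then have "?PA ?u a" using fu fC by auto
      then have u: "?u = p" using exA p by blast
      have "finsum M ?v {i \<in> ?I. ?v i \<noteq> \<zero>\<^bsub>M\<^esub>} = m" unfolding sp eqM
        by (rule M.add.finprod_cong') (use fC cM in \<open>auto simp: Pi_def\<close>)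
      then have "?PM ?v m" using fv fC by auto
      then have v: "?v = q" using exM q by blast
      show "f = ?f"
      proof
        fix i show "f i = ?f i"
          using f by (cases "i \<in> ?I") (auto simp flip: u v)
      qed
    qed
  qed
  ultimately show ?thesis by (simp add: internal_direct_sum_def)
qed

theorem trivial_extension_graded_ring:
  "graded_ring G (A \<propto> M) (trivial_extension_comp compA compM)"
proof (intro graded_ring.intro graded_ring_axioms.intro)
  fix g h a b
  assume gh: "g \<in> carrier G" "h \<in> carrier G"
    and "a \<in> trivial_extension_comp compA compM g" "b \<in> trivial_extension_comp compA compM h"
  then obtain a1 a2 b1 b2 where ab: "a = (a1, a2)" "b = (b1, b2)"
    "a1 \<in> compA g" "a2 \<in> compM g" "b1 \<in> compA h" "b2 \<in> compM h"
    by (auto simp: trivial_extension_comp_def)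
  have "additive_subgroup (compM (g \<otimes>\<^bsub>G\<^esub> h)) M"
    using direct_sum_module gh by (simp add: internal_direct_sum_def)
  then show "a \<otimes>\<^bsub>A \<propto> M\<^esub> b \<in> trivial_extension_comp compA compM (g \<otimes>\<^bsub>G\<^esub> h)"
    using gh ab by (simp add: trivial_extension_comp_def trivial_extension_simps
        comp_mult comp_left comp_right additive_subgroup.a_closed)
qed (fact G.group_axioms trivial_extension_ring trivial_extension_direct_sum)+

end

end

theory Submission
  imports Defs
begin

text \<open>
  Both directions only involve the projection \<open>(a, m) \<mapsto> a\<close>, whose kernel squares to zero: an element
  of \<open>A \<propto> M\<close> is nilpotent iff its first coordinate is. If \<open>a = r + n\<close> is a decomposition in \<open>A\<close>,
  then \<open>(a, m) = (r, 0) + (n, m)\<close> is one in \<open>A \<propto> M\<close>, provided that \<open>n\<close> and \<open>m\<close> have the same degree.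
  This can be arranged by replacing \<open>r\<close> and \<open>n\<close> with their components in the degree of \<open>a\<close>, each
  of which is the element itself or zero.
\<close>

section \<open>Homogeneous components of a sum in a graded ring\<close>

context graded_ring
begin

lemma comp_additive_subgroup: "g \<in> carrier G \<Longrightarrow> additive_subgroup (compR g) R"
  using direct_sum by (simp add: internal_direct_sum_def)

lemma comp_closed: "\<lbrakk>g \<in> carrier G; x \<in> compR g\<rbrakk> \<Longrightarrow> x \<in> carrier R"
  by (rule additive_subgroup.a_Hcarr[OF comp_additive_subgroup])

lemma zero_in_comp: "g \<in> carrier G \<Longrightarrow> \<zero>\<^bsub>R\<^esub> \<in> compR g"
  by (rule additive_subgroup.zero_closed[OF comp_additive_subgroup])

text \<open>Brings the uniqueness in \<open>internal_direct_sum\<close>, where each family is summed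
  over its own support, into a usable form: both families are summed over one finite
  \<open>S\<close> containing the two supports, so neither support has to be computed.\<close>

lemma decomposition_unique:
  assumes "f \<in> (\<Pi>\<^sub>E g\<in>carrier G. compR g)" "f' \<in> (\<Pi>\<^sub>E g\<in>carrier G. compR g)"
    and "finite S" "S \<subseteq> carrier G"
    and "{g \<in> carrier G. f g \<noteq> \<zero>\<^bsub>R\<^esub>} \<subseteq> S" "{g \<in> carrier G. f' g \<noteq> \<zero>\<^bsub>R\<^esub>} \<subseteq> S"
    and "finsum R f S = finsum R f' S"
  shows "f = f'"
proof -
  let ?P = "\<lambda>d. d \<in> (\<Pi>\<^sub>E g\<in>carrier G. compR g) \<and> finite {g \<in> carrier G. d g \<noteq> \<zero>\<^bsub>R\<^esub>} \<and>
    finsum R f S = finsum R d {g \<in> carrier G. d g \<noteq> \<zero>\<^bsub>R\<^esub>}"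
  have car: "f \<in> carrier G \<rightarrow> carrier R" "f' \<in> carrier G \<rightarrow> carrier R"
    using assms(1,2) comp_closed by (auto simp: PiE_def Pi_def)
  have "finsum R f S \<in> carrier R"
    using car assms(4) by (intro R.finsum_closed) auto
  then have ex1: "\<exists>!d. ?P d"
    using direct_sum by (simp add: internal_direct_sum_def)
  \<comment> \<open>Only zero terms are lost when \<open>S\<close> shrinks to a support, so
    \<open>f\<close> and \<open>f'\<close> both decompose the element \<open>finsum R f S\<close>;
    for \<open>f'\<close> this uses the assumed equality of the sums.\<close>
  have "finsum R f {g \<in> carrier G. f g \<noteq> \<zero>\<^bsub>R\<^esub>} = finsum R f S"
    "finsum R f' {g \<in> carrier G. f' g \<noteq> \<zero>\<^bsub>R\<^esub>} = finsum R f' S"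
    using car assms(3-6) by (auto intro!: finsum_support R.abelian_group_axioms)
  moreover have "finite {g \<in> carrier G. f g \<noteq> \<zero>\<^bsub>R\<^esub>}" "finite {g \<in> carrier G. f' g \<noteq> \<zero>\<^bsub>R\<^esub>}"
    using assms(3,5,6) finite_subset by blast+
  ultimately have "?P f" "?P f'"
    using assms(1,2,7) by simp_all
  then show ?thesis
    using ex1 by blast
qed

text \<open>Compares the components in degree \<open>g\<close> on both sides of
  \<open>x = r \<oplus> n\<close>. The conditionals also cover the degenerate cases, such as
  \<open>x\<close> zero with \<open>r\<close> and \<open>n\<close> opposite elements of another
  degree, and \<open>h = k\<close>.\<close>

lemma homogeneous_sum_component:
  assumes deg: "g \<in> carrier G" "h \<in> carrier G" "k \<in> carrier G"
    and mem: "x \<in> compR g" "r \<in> compR h" "n \<in> compR k"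
    and sum: "x = r \<oplus>\<^bsub>R\<^esub> n"
  shows "x = (if h = g then r else \<zero>\<^bsub>R\<^esub>) \<oplus>\<^bsub>R\<^esub> (if k = g then n else \<zero>\<^bsub>R\<^esub>)"
proof -
  \<comment> \<open>\<open>\<delta> j y\<close> is the family with \<open>y\<close> in degree
    \<open>j\<close> and zero in all other degrees. Adding the families of \<open>r\<close> and
    \<open>n\<close> pointwise treats equal and distinct degrees \<open>h\<close>, \<open>k\<close>
    alike, and \<open>?S\<close> contains every support involved. The restrictions to
    \<open>carrier G\<close> in \<open>?f\<close> and \<open>?f'\<close> make the families
    extensional, as uniqueness requires.\<close>
  define \<delta> :: "'g \<Rightarrow> 'a \<Rightarrow> 'g \<Rightarrow> 'a" where "\<delta> = (\<lambda>j y i. if j = i then y else \<zero>\<^bsub>R\<^esub>)"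
  let ?S = "{g, h, k}"
  let ?f = "\<lambda>i\<in>carrier G. \<delta> g x i"
  let ?f' = "\<lambda>i\<in>carrier G. \<delta> h r i \<oplus>\<^bsub>R\<^esub> \<delta> k n i"
  have car: "x \<in> carrier R" "r \<in> carrier R" "n \<in> carrier R"
    using deg mem comp_closed by auto
  have \<delta>_comp: "\<delta> j y i \<in> compR i" if "i \<in> carrier G" "y \<in> compR j" for i j y
    using that zero_in_comp by (auto simp: \<delta>_def)
  have \<delta>_closed: "\<delta> j y i \<in> carrier R" if "y \<in> carrier R" for i j y
    using that by (simp add: \<delta>_def)
  have \<delta>_sum: "finsum R (\<delta> j y) ?S = y" if "j \<in> ?S" "y \<in> carrier R" for j y
    using R.finsum_singleton[of j ?S "\<lambda>_. y"] that by (simp add: \<delta>_def)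
  have "?f = ?f'"
  proof (rule decomposition_unique[where S = ?S])
    show "?f \<in> (\<Pi>\<^sub>E g\<in>carrier G. compR g)"
      using mem \<delta>_comp by (simp add: PiE_def Pi_def)
    show "?f' \<in> (\<Pi>\<^sub>E g\<in>carrier G. compR g)"
      using mem \<delta>_comp comp_additive_subgroup
      by (simp add: PiE_def Pi_def additive_subgroup.a_closed)
    have "finsum R ?f ?S = finsum R (\<delta> g x) ?S"
      by (rule R.finsum_cong') (use deg car \<delta>_closed in auto)
    also have "\<dots> = finsum R (\<delta> h r) ?S \<oplus>\<^bsub>R\<^esub> finsum R (\<delta> k n) ?S"
      using \<delta>_sum car sum by simp
    also have "\<dots> = finsum R (\<lambda>i. \<delta> h r i \<oplus>\<^bsub>R\<^esub> \<delta> k n i) ?S"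
      by (rule R.finsum_addf[symmetric]) (use car \<delta>_closed in auto)
    also have "\<dots> = finsum R ?f' ?S"
      by (rule R.finsum_cong') (use deg car \<delta>_closed in auto)
    finally show "finsum R ?f ?S = finsum R ?f' ?S" .
  qed (use deg in \<open>auto simp: \<delta>_def split: if_splits\<close>)
  \<comment> \<open>The value of \<open>?f\<close> in degree \<open>g\<close> is \<open>x\<close>
    itself, and that of \<open>?f'\<close> is the claimed sum.\<close>
  then have "?f g = ?f' g" by (rule fun_cong)
  then show ?thesis using deg by (simp add: \<delta>_def)
qed

lemma zero_graded_regular: "\<zero>\<^bsub>R\<^esub> \<in> graded_regular G R compR"
proof -
  have "\<zero>\<^bsub>R\<^esub> \<in> homogeneous G compR"
    using zero_in_comp[OF G.one_closed] G.one_closed by (auto simp: homogeneous_def)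
  then show ?thesis by (force simp: graded_regular_def)
qed

lemma zero_nilpotent: "\<zero>\<^bsub>R\<^esub> \<in> nilpotents R"
  by (auto simp: nilpotents_def intro!: exI[of _ 1])

text \<open>The definition leaves the degrees of both summands free. A summand outside degree
  \<open>g\<close> can be replaced by zero, which is graded-regular, nilpotent and of every degree,
  so the required properties survive.\<close>

lemma graded_NR_clean_same_degree:
  assumes "graded_NR_clean G R compR" "g \<in> carrier G" "x \<in> compR g"
  obtains r n where "r \<in> graded_regular G R compR" "n \<in> nilpotents R"
    "r \<in> compR g" "n \<in> compR g" "x = r \<oplus>\<^bsub>R\<^esub> n"
proof -
  have "x \<in> homogeneous G compR"
    using assms(2,3) by (auto simp: homogeneous_def)
  then obtain r n where rn: "r \<in> graded_regular G R compR" "n \<in> nilpotents R"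
      "n \<in> homogeneous G compR" "x = r \<oplus>\<^bsub>R\<^esub> n"
    using assms(1) by (auto simp: graded_NR_clean_def)
  obtain h k where hk: "h \<in> carrier G" "r \<in> compR h" "k \<in> carrier G" "n \<in> compR k"
    using rn by (auto simp: graded_regular_def homogeneous_def)
  show thesis
  proof
    show "x = (if h = g then r else \<zero>\<^bsub>R\<^esub>) \<oplus>\<^bsub>R\<^esub> (if k = g then n else \<zero>\<^bsub>R\<^esub>)"
      using homogeneous_sum_component assms(2,3) hk rn(4) by blast
  qed (use assms(2) hk rn zero_graded_regular zero_nilpotent zero_in_comp in auto)
qed

end

section \<open>Nilpotent elements of the trivial extension\<close>

context bimodule
begin

lemma left_zero: "a \<in> carrier A \<Longrightarrow> a \<odot>\<^bsub>M\<^esub> \<zero>\<^bsub>M\<^esub> = \<zero>\<^bsub>M\<^esub>"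
  using left_add[of a "\<zero>\<^bsub>M\<^esub>" "\<zero>\<^bsub>M\<^esub>"] left_closed[of a "\<zero>\<^bsub>M\<^esub>"] M.add.l_cancel_one' by force

lemma right_zero: "a \<in> carrier A \<Longrightarrow> \<zero>\<^bsub>M\<^esub> \<odot>\<^sub>r\<^bsub>M\<^esub> a = \<zero>\<^bsub>M\<^esub>"
  using right_add[of a "\<zero>\<^bsub>M\<^esub>" "\<zero>\<^bsub>M\<^esub>"] right_closed[of a "\<zero>\<^bsub>M\<^esub>"] M.add.l_cancel_one' by force

lemma left_zero_scalar: "x \<in> carrier M \<Longrightarrow> \<zero>\<^bsub>A\<^esub> \<odot>\<^bsub>M\<^esub> x = \<zero>\<^bsub>M\<^esub>"
  using left_add_scalar[of "\<zero>\<^bsub>A\<^esub>" "\<zero>\<^bsub>A\<^esub>" x] left_closed[of "\<zero>\<^bsub>A\<^esub>" x] M.add.l_cancel_one' by force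

lemma right_zero_scalar: "x \<in> carrier M \<Longrightarrow> x \<odot>\<^sub>r\<^bsub>M\<^esub> \<zero>\<^bsub>A\<^esub> = \<zero>\<^bsub>M\<^esub>"
  using right_add_scalar[of "\<zero>\<^bsub>A\<^esub>" "\<zero>\<^bsub>A\<^esub>" x] right_closed[of "\<zero>\<^bsub>A\<^esub>" x] M.add.l_cancel_one' by force

lemma fst_trivial_extension_mult: "fst (x \<otimes>\<^bsub>A \<propto> M\<^esub> y) = fst x \<otimes>\<^bsub>A\<^esub> fst y"
  by (cases x; cases y) (simp add: trivial_extension_simps)

lemma fst_trivial_extension_pow: "fst (x [^]\<^bsub>A \<propto> M\<^esub> (n::nat)) = fst x [^]\<^bsub>A\<^esub> n"
  by (induction n) (simp_all add: trivial_extension_simps fst_trivial_extension_mult)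

lemma nilpotents_trivial_extension: "nilpotents (A \<propto> M) = nilpotents A \<times> carrier M"
proof -
  interpret T: ring "A \<propto> M" by (rule trivial_extension_ring)
  have "(a, m) \<in> nilpotents (A \<propto> M) \<longleftrightarrow> a \<in> nilpotents A \<and> m \<in> carrier M" for a m
  proof
    assume "(a, m) \<in> nilpotents (A \<propto> M)"
    then obtain n :: nat where n: "n > 0" "(a, m) [^]\<^bsub>A \<propto> M\<^esub> n = \<zero>\<^bsub>A \<propto> M\<^esub>"
      and am: "a \<in> carrier A" "m \<in> carrier M"
      by (auto simp: nilpotents_def trivial_extension_simps)
    have "a [^]\<^bsub>A\<^esub> n = \<zero>\<^bsub>A\<^esub>"
      using fst_trivial_extension_pow[of "(a, m)" n] n(2) by (simp add: trivial_extension_simps)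
    then show "a \<in> nilpotents A \<and> m \<in> carrier M"
      using n(1) am by (auto simp: nilpotents_def)
  next
    assume am: "a \<in> nilpotents A \<and> m \<in> carrier M"
    then obtain n :: nat where n: "n > 0" "a [^]\<^bsub>A\<^esub> n = \<zero>\<^bsub>A\<^esub>" and car: "(a, m) \<in> carrier (A \<propto> M)"
      by (auto simp: nilpotents_def trivial_extension_simps)
    obtain m' where m': "(a, m) [^]\<^bsub>A \<propto> M\<^esub> n = (\<zero>\<^bsub>A\<^esub>, m')" "m' \<in> carrier M"
      using n fst_trivial_extension_pow[of "(a, m)" n] T.nat_pow_closed[OF car, of n]
      by (cases "(a, m) [^]\<^bsub>A \<propto> M\<^esub> n") (auto simp: trivial_extension_simps)
    \<comment> \<open>The second coordinate \<open>m'\<close> of the \<open>n\<close>-th power need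
      not vanish. Squaring removes it, because in the product both \<open>m'\<close> terms are
      multiplied by the scalar zero; hence the exponent \<open>n + n\<close>.\<close>
    have "(a, m) [^]\<^bsub>A \<propto> M\<^esub> (n + n) = (\<zero>\<^bsub>A\<^esub>, m') \<otimes>\<^bsub>A \<propto> M\<^esub> (\<zero>\<^bsub>A\<^esub>, m')"
      using T.nat_pow_mult[OF car, of n n] m' by simp
    also have "\<dots> = \<zero>\<^bsub>A \<propto> M\<^esub>"
      using m' by (simp add: trivial_extension_simps left_zero_scalar right_zero_scalar)
    finally have "(a, m) [^]\<^bsub>A \<propto> M\<^esub> (n + n) = \<zero>\<^bsub>A \<propto> M\<^esub>" .
    moreover have "n + n > 0" using n(1) by simp
    ultimately show "(a, m) \<in> nilpotents (A \<propto> M)"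
      using car unfolding nilpotents_def by blast
  qed
  then show ?thesis by auto
qed

end

section \<open>Transfer of decompositions between the ring and its trivial extension\<close>

context graded_bimodule
begin

lemma comp_module_additive_subgroup: "g \<in> carrier G \<Longrightarrow> additive_subgroup (compM g) M"
  using direct_sum_module by (simp add: internal_direct_sum_def)

lemma comp_module_closed: "\<lbrakk>g \<in> carrier G; x \<in> compM g\<rbrakk> \<Longrightarrow> x \<in> carrier M"
  by (rule additive_subgroup.a_Hcarr[OF comp_module_additive_subgroup])

lemma zero_in_comp_module: "g \<in> carrier G \<Longrightarrow> \<zero>\<^bsub>M\<^esub> \<in> compM g"
  by (rule additive_subgroup.zero_closed[OF comp_module_additive_subgroup])

lemma homogeneous_trivial_extension_fst:
  "x \<in> homogeneous G (trivial_extension_comp compA compM) \<Longrightarrow> fst x \<in> homogeneous G compA"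
  by (auto simp: homogeneous_def trivial_extension_comp_def)

text \<open>Zero lies in every \<open>compM g\<close>, so it matches the degree of \<open>a\<close>
  whatever that is.\<close>

lemma homogeneous_trivial_extension_zero:
  "a \<in> homogeneous G compA \<Longrightarrow> (a, \<zero>\<^bsub>M\<^esub>) \<in> homogeneous G (trivial_extension_comp compA compM)"
  using zero_in_comp_module by (auto simp: homogeneous_def trivial_extension_comp_def)

text \<open>The projection is multiplicative and preserves degrees, so the first coordinate of the
  homogeneous \<open>y\<close> with \<open>x = x y x\<close> serves for
  \<open>fst x\<close>.\<close>

lemma graded_regular_trivial_extension_fst:
  assumes "x \<in> graded_regular G (A \<propto> M) (trivial_extension_comp compA compM)"
  shows "fst x \<in> graded_regular G A compA"
proof -
  obtain y where y: "y \<in> homogeneous G (trivial_extension_comp compA compM)"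
      "x = x \<otimes>\<^bsub>A \<propto> M\<^esub> y \<otimes>\<^bsub>A \<propto> M\<^esub> x"
    using assms by (auto simp: graded_regular_def)
  have "fst x = fst x \<otimes>\<^bsub>A\<^esub> fst y \<otimes>\<^bsub>A\<^esub> fst x"
    using arg_cong[OF y(2), of fst] by (simp add: fst_trivial_extension_mult)
  moreover have "fst x \<in> homogeneous G compA"
    using assms homogeneous_trivial_extension_fst by (simp add: graded_regular_def)
  ultimately show ?thesis
    using homogeneous_trivial_extension_fst[OF y(1)] unfolding graded_regular_def by blast
qed

text \<open>The embedding of \<open>a\<close> as \<open>(a, 0)\<close> is multiplicative, so
  \<open>(s, 0)\<close> works when \<open>s\<close> does. The second coordinate matters:
  \<open>(0, m)\<close> with \<open>m\<close> nonzero is never graded-regular, since every product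
  \<open>(0, m) y (0, m)\<close> vanishes.\<close>

lemma graded_regular_trivial_extension_zero:
  assumes "r \<in> graded_regular G A compA"
  shows "(r, \<zero>\<^bsub>M\<^esub>) \<in> graded_regular G (A \<propto> M) (trivial_extension_comp compA compM)"
proof -
  obtain s where s: "r \<in> homogeneous G compA" "s \<in> homogeneous G compA" "r = r \<otimes>\<^bsub>A\<^esub> s \<otimes>\<^bsub>A\<^esub> r"
    using assms by (auto simp: graded_regular_def)
  then have "r \<in> carrier A" "s \<in> carrier A"
    using comp_closed by (auto simp: homogeneous_def)
  then have "(r, \<zero>\<^bsub>M\<^esub>) = (r, \<zero>\<^bsub>M\<^esub>) \<otimes>\<^bsub>A \<propto> M\<^esub> (s, \<zero>\<^bsub>M\<^esub>) \<otimes>\<^bsub>A \<propto> M\<^esub> (r, \<zero>\<^bsub>M\<^esub>)"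
    using s(3) by (simp add: trivial_extension_simps left_zero right_zero)
  then show ?thesis
    using s(1,2) homogeneous_trivial_extension_zero unfolding graded_regular_def by blast
qed

text \<open>A decomposition of \<open>(a, 0)\<close> projects to one of \<open>a\<close>, since the
  projection is additive and preserves graded-regular, nilpotent and homogeneous elements.\<close>

lemma graded_NR_clean_trivial_extensionD:
  assumes "graded_NR_clean G (A \<propto> M) (trivial_extension_comp compA compM)"
  shows "graded_NR_clean G A compA"
  unfolding graded_NR_clean_def
proof
  fix a assume "a \<in> homogeneous G compA"
  then have "(a, \<zero>\<^bsub>M\<^esub>) \<in> homogeneous G (trivial_extension_comp compA compM)"
    by (rule homogeneous_trivial_extension_zero)
  from bspec[OF assms[unfolded graded_NR_clean_def] this] obtain x y
    where x: "x \<in> graded_regular G (A \<propto> M) (trivial_extension_comp compA compM)"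
    and y: "y \<in> nilpotents (A \<propto> M)" "y \<in> homogeneous G (trivial_extension_comp compA compM)"
    and sum: "(a, \<zero>\<^bsub>M\<^esub>) = x \<oplus>\<^bsub>A \<propto> M\<^esub> y"
    by (elim bexE IntE)
  have "a = fst x \<oplus>\<^bsub>A\<^esub> fst y"
    using sum by (cases x; cases y) (simp add: trivial_extension_simps)
  moreover have "fst y \<in> nilpotents A \<inter> homogeneous G compA"
    using y homogeneous_trivial_extension_fst by (auto simp: nilpotents_trivial_extension)
  ultimately show "\<exists>r\<in>graded_regular G A compA. \<exists>n\<in>nilpotents A \<inter> homogeneous G compA.
      a = r \<oplus>\<^bsub>A\<^esub> n"
    using graded_regular_trivial_extension_fst[OF x] by blast
qed

lemma graded_NR_clean_trivial_extensionI:
  assumes "graded_NR_clean G A compA"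
  shows "graded_NR_clean G (A \<propto> M) (trivial_extension_comp compA compM)"
  unfolding graded_NR_clean_def
proof
  fix x assume "x \<in> homogeneous G (trivial_extension_comp compA compM)"
  then obtain g a m where x: "x = (a, m)" "g \<in> carrier G" "a \<in> compA g" "m \<in> compM g"
    by (auto simp: homogeneous_def trivial_extension_comp_def)
  obtain r n where rn: "r \<in> graded_regular G A compA" "n \<in> nilpotents A" "n \<in> compA g"
      "a = r \<oplus>\<^bsub>A\<^esub> n"
    using graded_NR_clean_same_degree[OF assms x(2,3)] by metis
  have m: "m \<in> carrier M" using x comp_module_closed by blast
  \<comment> \<open>All of \<open>m\<close> goes into the nilpotent summand, where any second
    coordinate is allowed. Homogeneity of \<open>(n, m)\<close> then rests on \<open>n\<close>
    having the degree \<open>g\<close> of \<open>m\<close>.\<close>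
  then have "x = (r, \<zero>\<^bsub>M\<^esub>) \<oplus>\<^bsub>A \<propto> M\<^esub> (n, m)"
    using x(1) rn(4) by (simp add: trivial_extension_simps)
  moreover have "(n, m) \<in> nilpotents (A \<propto> M)"
    using rn(2) m by (simp add: nilpotents_trivial_extension)
  moreover have "(n, m) \<in> homogeneous G (trivial_extension_comp compA compM)"
    using x rn(3) by (auto simp: homogeneous_def trivial_extension_comp_def)
  ultimately show "\<exists>r\<in>graded_regular G (A \<propto> M) (trivial_extension_comp compA compM).
      \<exists>n\<in>nilpotents (A \<propto> M) \<inter> homogeneous G (trivial_extension_comp compA compM).
        x = r \<oplus>\<^bsub>A \<propto> M\<^esub> n"
    using graded_regular_trivial_extension_zero[OF rn(1)] by blast
qed

end

theorem theorem3p4: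
  fixes G :: "('g, 'k) monoid_scheme"
    and A :: "('a, 'b) ring_scheme" and compA :: "'g \<Rightarrow> 'a set"
    and M :: "('a, 'm, 'c) bimodule_scheme" and compM :: "'g \<Rightarrow> 'm set"
  assumes "group G"
    and "graded_ring G A compA"
    and "graded_bimodule G A compA M compM"
  shows "graded_NR_clean G (A \<propto> M) (trivial_extension_comp compA compM)
     \<longleftrightarrow> graded_NR_clean G A compA"
  using graded_bimodule.graded_NR_clean_trivial_extensionD[OF assms(3)]
    graded_bimodule.graded_NR_clean_trivial_extensionI[OF assms(3)] by blast

end
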